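(* Let $m,n\in\mathbb{Z}$ with $\gcd(m,n)=1$ and $mn(m+n)\neq 0$, and put $c=-\frac{A(m,n)}{B(m,n)}$. (a) The fraction $\frac{A(m,n)}{B(m,n)}$ is in lowest terms; in particular the exact denominator of $c$ is $B(m,n)=16\,C(m,n)^2$, where $C(m,n)=\frac{mn(m+n)}{2}\in\mathbb{Z}$. (b) $c=-\dfrac{\mathrm{N}_{\mathbb{Q}(\zeta)/\mathbb{Q}}\big(m-(\zeta+\zeta^2)n\big)}{(4C(m,n))^2}$, where $\zeta=e^{2\pi i/7}$. (c) $c=-\tfrac{29}{16}$ is the only rational number whose denominator is a power of $2$ for which $f_c$ has a rational $3$-cycle. (d) If $c$ is the only rational number with its denominator for which $f_c$ has a rational $3$-cycle, then $c=-\tfrac{29}{16}$. (e) If $A(m,n)=q^e$ is a power of a prime $q\neq 7$, then $c$ is the only rational number with numerator $-q^e$ (i.e. $c=-q^e/D$ in lowest terms for some $D$) for which $f_c$ has a rational $3$-cycle. The same conclusion holds if $A(m,n)=7q^e$ for some prime power $q^e$.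
   Context: For $c\in\mathbb{Q}$ let $f_c(x)=x^2+c$; a rational $3$-cycle is the orbit of a rational point of minimal period $3$. Define $A(m,n)=m^6+2m^5n+4m^4n^2+8m^3n^3+9m^2n^4+4mn^5+n^6$, $B(m,n)=4m^2n^2(m+n)^2$. Standing fact (from the rational parametrization of period-3 points): $f_c$ has a rational $3$-cycle if and only if $c=-A(m,n)/B(m,n)$ for some $m,n\in\mathbb{Z}$ with $\gcd(m,n)=1$ and $mn(m+n)\neq0$; and $f_c$ has at most one rational $3$-cycle. *)

theory Defs
  imports Complex_Main "HOL-Computational_Algebra.Primes"
begin

definition fc :: "rat \<Rightarrow> rat \<Rightarrow> rat" where
  "fc c x = x ^ 2 + c"

definition min_period :: "('a \<Rightarrow> 'a) \<Rightarrow> nat \<Rightarrow> 'a \<Rightarrow> bool" where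
  "min_period g p x \<longleftrightarrow> 0 < p \<and> (g ^^ p) x = x \<and> (\<forall>k. 0 < k \<and> k < p \<longrightarrow> (g ^^ k) x \<noteq> x)"

definition has_rat_3cycle :: "rat \<Rightarrow> bool" where
  "has_rat_3cycle c \<longleftrightarrow> (\<exists>x::rat. min_period (fc c) 3 x)"

definition polyA :: "int \<Rightarrow> int \<Rightarrow> int" where
  "polyA m n = m^6 + 2*m^5*n + 4*m^4*n^2 + 8*m^3*n^3 + 9*m^2*n^4 + 4*m*n^5 + n^6"

definition polyB :: "int \<Rightarrow> int \<Rightarrow> int" where
  "polyB m n = 4*m^2*n^2*(m+n)^2"

definition polyC :: "int \<Rightarrow> int \<Rightarrow> int" where
  "polyC m n = (m*n*(m+n)) div 2"

definition zeta7 :: complex where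
  "zeta7 = exp (2 * pi * \<i> / 7)"

text \<open>Norm from Q(zeta7) to Q of the element m - (zeta + zeta^2) n: the product of its
  images under all six embeddings zeta \<mapsto> zeta^k, k = 1..6.\<close>
definition norm_elt :: "int \<Rightarrow> int \<Rightarrow> complex" where
  "norm_elt m n = (\<Prod>k\<in>{1..6::nat}. of_int m - (zeta7 ^ k + zeta7 ^ (2*k)) * of_int n)"

definition rnum :: "rat \<Rightarrow> int" where "rnum q = fst (quotient_of q)"
definition rden :: "rat \<Rightarrow> int" where "rden q = snd (quotient_of q)"

end

theory Submission
  imports Defs
begin

text \<open>If $x_1, x_2, x_3$ is a 3-cycle of $f_c$ and $\tau = x_1 + x_2$, then the differences of
  consecutive points determine the other two pair sums as rational functions of $\tau$, hence the
  cycle and $c$; writing $\tau = m/n$ gives the parametrization by $A$ and $B$.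

  The uniqueness statement for prime powers rests on the identity $A = R^2 + 7 T^2$ with
  $R = m^3 + m^2 n - 2 m n^2 - n^3$ and $T = mn(m+n)$ (the norm from $\mathbb{Q}(\zeta)$ taken in
  two steps through $\mathbb{Q}(\sqrt{-7})$), together with Euler's argument that a power of an odd
  prime is represented by $x^2 + 7 y^2$ with $x, y$ coprime in at most one way up to signs.
  Since $B = 4 T^2$, this determines $c$.\<close>

section \<open>Parametrization of rational 3-cycles\<close>

text \<open>This is -A(t,1)/B(t,1), with t the sum of two consecutive points of the cycle.\<close>

definition cycle_param :: "rat \<Rightarrow> rat" where
  "cycle_param t = - (t^6 + 2*t^5 + 4*t^4 + 8*t^3 + 9*t^2 + 4*t + 1) / (4 * t^2 * (t + 1)^2)"

lemma has_rat_3cycle_iff: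
  "has_rat_3cycle c \<longleftrightarrow> (\<exists>x y z. y = x^2 + c \<and> z = y^2 + c \<and> x = z^2 + c \<and> y \<noteq> x \<and> z \<noteq> x)"
proof -
  have less3: "(\<forall>k. 0 < k \<and> k < 3 \<longrightarrow> P k) \<longleftrightarrow> P (1::nat) \<and> P 2" for P
    by (auto simp: numeral_3_eq_3 less_Suc_eq numeral_2_eq_2)
  show ?thesis
    unfolding has_rat_3cycle_def min_period_def less3
    by (auto simp: numeral_3_eq_3 numeral_2_eq_2 fc_def) metis+
qed

lemma has_rat_3cycle_imp_param:
  assumes "has_rat_3cycle c"
  obtains t where "t \<noteq> 0" "t + 1 \<noteq> 0" "c = cycle_param t"
proof -
  obtain x y z where xyz: "y = x^2 + c" "z = y^2 + c" "x = z^2 + c" "y \<noteq> x" "z \<noteq> x"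
    using assms has_rat_3cycle_iff by blast
  define t where "t = x + y"
  define u where "u = y + z"
  define v where "v = z + x"
  \<comment> \<open>Each is the factorization f(a) - f(b) = (a - b)(a + b).\<close>
  have d1: "y - z = (x - y) * t" and d2: "z - x = (y - z) * u" and d3: "x - y = (z - x) * v"
    using xyz(1-3) unfolding t_def u_def v_def by algebra+
  have "t + 1 \<noteq> 0" using d1 xyz(5) by (auto simp: algebra_simps add_eq_0_iff)
  have "t \<noteq> 0" using d1 d2 xyz(5) by auto
  \<comment> \<open>The three successive differences add up to zero, and each is a multiple of
    \<open>x - y\<close>.\<close>
  have "(x - y) * (t * u + 1 + t) = 0" using d1 d2 by algebra
  hence "t * u + 1 + t = 0" using xyz(4) by simp
  hence u: "u = - (1 + t) / t" using \<open>t \<noteq> 0\<close> by (simp add: field_simps)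
  have "(x - y) * ((1 + t) * v + 1) = 0" using d1 d3 by algebra
  hence "(1 + t) * v + 1 = 0" using xyz(4) by simp
  hence v: "v = - 1 / (t + 1)" using \<open>t + 1 \<noteq> 0\<close> by (simp add: field_simps)
  \<comment> \<open>The pair sums recover the points: this is c = y - x^2.\<close>
  have c: "c = (t + u - v) / 2 - ((t + v - u) / 2)^2"
    using xyz(1) by (simp add: t_def u_def v_def field_simps)
  have "c = cycle_param t"
    unfolding c u v cycle_param_def using \<open>t \<noteq> 0\<close> \<open>t + 1 \<noteq> 0\<close>
    by (simp add: divide_simps) algebra
  with \<open>t \<noteq> 0\<close> \<open>t + 1 \<noteq> 0\<close> show ?thesis using that by blast
qed

lemma has_rat_3cycle_param:
  assumes "t \<noteq> 0" "t + 1 \<noteq> 0"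
  shows "has_rat_3cycle (cycle_param t)"
proof -
  define d where "d = 2 * t * (t + 1)"
  \<comment> \<open>The points are (t + v - u)/2, (t + u - v)/2 and (u + v - t)/2 for u = -(1 + t)/t
    and v = -1/(t + 1), over the common denominator \<open>d\<close>.\<close>
  define x where "x = (t^3 + 2*t^2 + t + 1) / d"
  define y where "y = (t^3 - t - 1) / d"
  define z where "z = - (t^3 + 2*t^2 + 3*t + 1) / d"
  have d0: "d \<noteq> 0" using assms by (simp add: d_def)
  have c: "cycle_param t = - (t^6 + 2*t^5 + 4*t^4 + 8*t^3 + 9*t^2 + 4*t + 1) / d^2"
    by (simp add: cycle_param_def d_def power_mult_distrib)
  \<comment> \<open>This factor occurs in the differences \<open>x - y\<close> and
    \<open>x - z\<close>, so the cycle cannot collapse to a fixed point.\<close>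
  have pos: "t^2 + t + 1 \<noteq> 0"
  proof -
    have "t^2 + t + 1 = (t + 1/2)^2 + 3/4" by (simp add: power2_eq_square algebra_simps)
    also have "\<dots> > 0" by (rule add_nonneg_pos) auto
    finally show ?thesis by simp
  qed
  have "y = x^2 + cycle_param t" "z = y^2 + cycle_param t" "x = z^2 + cycle_param t"
    unfolding x_def y_def z_def c using d0
    by (simp_all add: divide_simps) (unfold d_def, algebra+)
  moreover have "x - y = 2 * (t^2 + t + 1) / d"
    using d0 by (simp add: x_def y_def divide_simps)
  hence "y \<noteq> x" using pos d0 by auto
  moreover have "x - z = 2 * ((t + 1) * (t^2 + t + 1)) / d"
    using d0 by (simp add: x_def z_def divide_simps) algebra
  hence "z \<noteq> x" using pos d0 assms(2) by auto
  ultimately show ?thesis using has_rat_3cycle_iff by blast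
qed

lemma cycle_param_of_int_div:
  assumes "n \<noteq> 0"
  shows "cycle_param (of_int m / of_int n) = - of_int (polyA m n) / of_int (polyB m n)"
proof -
  define a b :: rat where "a = of_int m" and "b = of_int n"
  have b: "b \<noteq> 0" using assms by (simp add: b_def)
  have A: "of_int (polyA m n)
      = b^6 * ((a/b)^6 + 2*(a/b)^5 + 4*(a/b)^4 + 8*(a/b)^3 + 9*(a/b)^2 + 4*(a/b) + 1)"
    using b by (simp add: polyA_def a_def[symmetric] b_def[symmetric] field_simps power_divide eval_nat_numeral)
  have B: "of_int (polyB m n) = b^6 * (4 * (a/b)^2 * (a/b + 1)^2)"
    using b by (simp add: polyB_def a_def[symmetric] b_def[symmetric] field_simps power_divide eval_nat_numeral)
  show ?thesis
    unfolding A B cycle_param_def a_def[symmetric] b_def[symmetric] minus_divide_left[symmetric]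
    using b by (subst mult_divide_mult_cancel_left) simp_all
qed

lemma has_rat_3cycle_imp_polyA_polyB:
  assumes "has_rat_3cycle c"
  obtains m n where "coprime m n" "m * n * (m + n) \<noteq> 0"
    "c = - of_int (polyA m n) / of_int (polyB m n)"
proof -
  obtain t where t: "t \<noteq> 0" "t + 1 \<noteq> 0" "c = cycle_param t"
    using has_rat_3cycle_imp_param[OF assms] .
  obtain m n where q: "quotient_of t = (m, n)" by (cases "quotient_of t")
  have n: "n > 0" "coprime m n" and tmn: "t = of_int m / of_int n"
    using quotient_of_denom_pos[OF q] quotient_of_coprime[OF q] quotient_of_div[OF q] by auto
  have "m \<noteq> 0" using t(1) tmn by auto
  moreover have "m + n \<noteq> 0"
  proof
    assume "m + n = 0"
    hence "m = - n" by simp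
    thus False using t(2) n(1) by (simp add: tmn)
  qed
  ultimately show ?thesis
    using that n t(3) cycle_param_of_int_div[of n m] by (simp add: tmn)
qed

lemma has_rat_3cycle_polyA_polyB:
  assumes "m * n * (m + n) \<noteq> 0"
  shows "has_rat_3cycle (- of_int (polyA m n) / of_int (polyB m n))"
proof -
  have "n \<noteq> 0" using assms by auto
  hence "of_int m / of_int n + 1 = (of_int (m + n) / of_int n :: rat)"
    by (simp add: field_simps)
  moreover have "of_int (m + n) \<noteq> (0 :: rat)" using assms by (subst of_int_eq_0_iff) auto
  ultimately show ?thesis
    using has_rat_3cycle_param[of "of_int m / of_int n"] assms
    by (simp add: cycle_param_of_int_div)
qed

section \<open>Arithmetic of the forms A and B\<close>

text \<open>Modulo m, n and m + n the form A reduces to n^6, m^6 and m^6 respectively.\<close>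

lemma coprime_polyA_mn:
  assumes "coprime m n"
  shows "coprime (polyA m n) (m * n * (m + n))"
proof -
  have m: "coprime (polyA m n) m"
  proof -
    have "polyA m n = n^6 + (m^5 + 2*m^4*n + 4*m^3*n^2 + 8*m^2*n^3 + 9*m*n^4 + 4*n^5) * m"
      unfolding polyA_def by algebra
    moreover have "coprime (n^6) m" using assms by (simp add: coprime_commute)
    ultimately show ?thesis by (metis coprime_iff_gcd_eq_1 gcd_add_mult gcd.commute add.commute)
  qed
  have n: "coprime (polyA m n) n"
  proof -
    have "polyA m n = m^6 + (2*m^5 + 4*m^4*n + 8*m^3*n^2 + 9*m^2*n^3 + 4*m*n^4 + n^5) * n"
      unfolding polyA_def by algebra
    moreover have "coprime (m^6) n" using assms by simp
    ultimately show ?thesis by (metis coprime_iff_gcd_eq_1 gcd_add_mult gcd.commute add.commute)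
  qed
  have s: "coprime (polyA m n) (m + n)"
  proof -
    have "polyA m n = m^6 + (n * (2*m^4 + 2*m^3*n + 6*m^2*n^2 + 3*m*n^3 + n^4)) * (m + n)"
      unfolding polyA_def by algebra
    moreover have "coprime m (m + n)" using assms by (simp add: coprime_iff_gcd_eq_1)
    hence "coprime (m^6) (m + n)" by simp
    ultimately show ?thesis by (metis coprime_iff_gcd_eq_1 gcd_add_mult gcd.commute add.commute)
  qed
  show ?thesis using m n s by simp
qed

lemma even_mn_sum: "even (m * n * (m + n))" for m n :: int
  by auto

lemma polyB_eq: "polyB m n = 4 * (m * n * (m + n))^2"
  by (simp add: polyB_def power_mult_distrib)

lemma polyB_eq_polyC: "polyB m n = 16 * (polyC m n)^2"
proof -
  have "m * n * (m + n) = 2 * polyC m n"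
    unfolding polyC_def using even_mn_sum by (metis dvd_mult_div_cancel)
  thus ?thesis by (simp add: polyB_eq power_mult_distrib)
qed

lemma polyB_pos:
  assumes "m * n * (m + n) \<noteq> 0"
  shows "polyB m n > 0"
  using assms by (simp add: polyB_eq)

lemma odd_polyA:
  assumes "coprime m n"
  shows "odd (polyA m n)"
  using coprime_common_divisor[OF coprime_polyA_mn[OF assms], of 2] even_mn_sum by auto

lemma coprime_polyA_polyB:
  assumes "coprime m n"
  shows "coprime (polyA m n) (polyB m n)"
proof -
  have "coprime (polyA m n) 2"
    using odd_polyA[OF assms] by simp
  hence "coprime (polyA m n) (2^2)" by (simp only: coprime_power_right_iff) simp
  thus ?thesis
    using coprime_polyA_mn[OF assms] unfolding polyB_eq by simp
qed

lemma quotient_of_polyA_polyB: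
  assumes "coprime m n" "m * n * (m + n) \<noteq> 0"
  shows "quotient_of (- of_int (polyA m n) / of_int (polyB m n)) = (- polyA m n, polyB m n)"
proof -
  have "- of_int (polyA m n) / of_int (polyB m n) = Rat.Fract (- polyA m n) (polyB m n)"
    by (simp add: Fract_of_int_quotient)
  thus ?thesis
    using coprime_polyA_polyB[OF assms(1)] polyB_pos[OF assms(2)]
    by (simp add: quotient_of_Fract normalize_stable)
qed

text \<open>The three cases say that two entries of the zero-sum triple m, n, -(m + n) coincide; up
  to scaling and order the triple is 1, 1, -2.\<close>

lemma polyA_div_polyB_isosceles:
  assumes "m * n * (m + n) \<noteq> 0" "m = n \<or> n = - 2 * m \<or> m = - 2 * n"
  shows "- of_int (polyA m n) / of_int (polyB m n) = (-29/16 :: rat)"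
proof -
  have "16 * polyA m n = 29 * polyB m n"
    using assms(2) unfolding polyA_def polyB_def by (elim disjE; hypsubst; simp add: eval_nat_numeral algebra_simps)
  hence "16 * (of_int (polyA m n) :: rat) = 29 * of_int (polyB m n)"
    by (metis of_int_mult of_int_numeral)
  thus ?thesis using polyB_pos[OF assms(1)] by (simp add: field_simps)
qed

text \<open>B is symmetric in m and n but A is not; when mn(m + n) is nonzero, the difference
  vanishes only in the isosceles cases.\<close>

lemma polyA_swap_diff:
  "polyA n m - polyA m n = m * n * (m + n) * ((m - n) * (2*m + n) * (m + 2*n))"
  unfolding polyA_def by algebra

lemma abs_eq_1_if_odd_dvd_power_2:
  fixes x :: int
  assumes "odd x" "x dvd 2^k"
  shows "\<bar>x\<bar> = 1"
proof -
  have "coprime x (2^k)" using assms(1) by simp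
  thus ?thesis using assms(2) by (metis coprime_absorb_left zdvd1_eq is_unit_gcd)
qed

text \<open>All of m, n and m + n divide the power of 2, and two of them are odd, hence 1 or -1.
  Since none is zero, the signs are forced.\<close>

lemma isosceles_if_polyB_power_2:
  assumes "coprime m n" "m * n * (m + n) \<noteq> 0" "polyB m n = 2^k"
  shows "m = n \<or> n = - 2 * m \<or> m = - 2 * n"
proof -
  have "m * (4 * m * n^2 * (m+n)^2) = 2^k" "n * (4 * m^2 * n * (m+n)^2) = 2^k"
    "(m + n) * (4 * m^2 * n^2 * (m+n)) = 2^k"
    unfolding assms(3)[symmetric] polyB_def by algebra+
  hence dvd: "m dvd 2^k" "n dvd 2^k" "(m + n) dvd 2^k" by (metis dvd_triv_left)+
  have "odd m \<or> odd n" using assms(1) by (metis coprime_common_divisor odd_one)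
  then consider "odd m" "odd n" | "odd m" "odd (m + n)" | "odd n" "odd (m + n)" by auto
  thus ?thesis
    using abs_eq_1_if_odd_dvd_power_2[OF _ dvd(1)] abs_eq_1_if_odd_dvd_power_2[OF _ dvd(2)]
      abs_eq_1_if_odd_dvd_power_2[OF _ dvd(3)] assms(2)
    by cases (auto simp: abs_if split: if_splits)
qed

section \<open>Prime powers represented by A\<close>

lemma polyA_eq_x2_plus_7y2:
  "polyA m n = (m^3 + m^2*n - 2*m*n^2 - n^3)^2 + 7 * (m * n * (m + n))^2"
  unfolding polyA_def by algebra

text \<open>The product (xy' - x'y)(xy' + x'y) is a multiple of q^e, and q divides at most one
  factor, so q^e divides one of them. Composing the two representations then forces that factor to
  vanish.\<close>

lemma x2_plus_7y2_prime_power_unique: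
  fixes q x y x' y' :: int
  assumes q: "prime q" "odd q" "q \<noteq> 7" "e \<ge> 1"
    and xy: "q^e = x^2 + 7 * y^2" "coprime x y"
    and xy': "q^e = x'^2 + 7 * y'^2" "coprime x' y'"
  shows "y^2 = y'^2"
proof -
  \<comment> \<open>Naming the power lets \<open>algebra\<close> treat it as an atom despite the
    symbolic exponent.\<close>
  define Q where "Q = q^e"
  note Q = xy(1)[folded Q_def] xy'(1)[folded Q_def]
  have ndvd: "\<not> q dvd a \<and> \<not> q dvd b" if ab: "q^e = a^2 + 7 * b^2" "coprime a b" for a b
  proof -
    have qe: "q dvd a^2 + 7 * b^2" using q(4) unfolding ab(1)[symmetric] by simp
    have "\<not> q dvd 7"
      using q(1,3) primes_dvd_imp_eq[of q 7] by auto
    hence "q dvd a \<longleftrightarrow> q dvd b"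
      using qe q(1) by (auto simp: prime_dvd_power_iff prime_dvd_mult_iff dvd_add_right_iff
          dvd_add_left_iff power2_eq_square)
    thus ?thesis using ab(2) q(1) by (metis coprime_common_divisor not_prime_unit)
  qed
  have qe_dvd: "q^e dvd (x * y' - x' * y) * (x * y' + x' * y)"
  proof -
    have "(x * y' - x' * y) * (x * y' + x' * y) = q^e * (y'^2 - y^2)"
      using Q unfolding Q_def[symmetric] by algebra
    thus ?thesis by simp
  qed
  have "\<not> (q dvd x * y' - x' * y \<and> q dvd x * y' + x' * y)"
  proof
    assume "q dvd x * y' - x' * y \<and> q dvd x * y' + x' * y"
    hence "q dvd (x * y' - x' * y) + (x * y' + x' * y)" by (metis dvd_add)
    hence "q dvd 2 * (x * y')" by simp
    hence "q dvd 2"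
      using ndvd[OF xy] ndvd[OF xy'] q(1) by (simp add: prime_dvd_mult_iff)
    thus False using q(1,2) primes_dvd_imp_eq[of q 2] by (auto simp: two_is_prime_nat)
  qed
  hence "coprime (q^e) (x * y' - x' * y) \<or> coprime (q^e) (x * y' + x' * y)"
    using q(1) by (auto simp: prime_imp_coprime)
  hence dvd: "q^e dvd x * y' - x' * y \<or> q^e dvd x * y' + x' * y"
    using qe_dvd by (metis coprime_dvd_mult_right_iff coprime_dvd_mult_left_iff)
  \<comment> \<open>A nonzero multiple s of q^e would make 7s^2 exceed (q^e)^2.\<close>
  have zero: "s = 0" if "q^e dvd s" "(q^e)^2 = r^2 + 7 * s^2" for r s :: int
  proof (rule ccontr)
    assume "s \<noteq> 0"
    hence "q^e \<le> \<bar>s\<bar>" using that(1) by (metis dvd_imp_le_int abs_of_pos q(1) prime_gt_0_int zero_less_power)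
    hence "(q^e)^2 \<le> s^2" using q(1) by (metis abs_le_square_iff abs_of_pos prime_gt_0_int zero_less_power)
    moreover have "s^2 > 0" using \<open>s \<noteq> 0\<close> by simp
    ultimately show False using that(2) by (smt (verit) zero_le_power2)
  qed
  \<comment> \<open>Brahmagupta's composition identity, with both choices of sign.\<close>
  have "(q^e)^2 = (x * x' + 7 * y * y')^2 + 7 * (x * y' - x' * y)^2"
    "(q^e)^2 = (x * x' - 7 * y * y')^2 + 7 * (x * y' + x' * y)^2"
    using Q unfolding Q_def[symmetric] by algebra+
  hence "x * y' - x' * y = 0 \<or> x * y' + x' * y = 0" using dvd zero by blast
  hence "(x * y' - x' * y) * (x * y' + x' * y) = 0" by simp
  hence "q^e * (y'^2 - y^2) = 0" using Q unfolding Q_def[symmetric] by algebra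
  thus ?thesis using q(1) by auto
qed

lemma polyB_unique_prime_power:
  assumes cop: "coprime m n" "coprime m' n'" and eq: "polyA m' n' = polyA m n"
    and pp: "(\<exists>q e. prime q \<and> q \<noteq> 7 \<and> e \<ge> 1 \<and> polyA m n = q ^ e)
          \<or> (\<exists>q e. prime q \<and> e \<ge> 1 \<and> polyA m n = 7 * q ^ e)"
  shows "polyB m' n' = polyB m n"
proof -
  define R T where "R m n = m^3 + m^2*n - 2*m*n^2 - n^3" and "T m n = m * n * (m + n)" for m n :: int
  have A: "polyA m n = (R m n)^2 + 7 * (T m n)^2" for m n
    by (simp add: R_def T_def polyA_eq_x2_plus_7y2)
  have RT: "coprime (R m n) (T m n)" if "coprime m n" for m n
  proof (rule coprimeI)
    fix d assume d: "d dvd R m n" "d dvd T m n"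
    hence "d dvd polyA m n" unfolding A by (simp add: power2_eq_square)
    thus "is_unit d"
      using d(2) coprime_polyA_mn[OF that] unfolding T_def by (metis coprime_common_divisor)
  qed
  have "(T m' n')^2 = (T m n)^2"
    using pp
  proof (elim disjE exE conjE)
    fix q :: int and e assume q: "prime q" "q \<noteq> 7" "e \<ge> 1" "polyA m n = q^e"
    have "odd q" using odd_polyA[OF cop(1)] q(3,4) by simp
    thus ?thesis
      using x2_plus_7y2_prime_power_unique[of q e "R m' n'" "T m' n'" "R m n" "T m n"]
        q A[of m n] A[of m' n'] eq RT cop by simp
  next
    fix q :: int and e assume q: "prime q" "e \<ge> 1" "polyA m n = 7 * q^e"
    have "odd q" using odd_polyA[OF cop(1)] q(2,3) by simp
    have p7: "prime (7::int)" by simp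
    \<comment> \<open>Dividing R^2 + 7 T^2 = 7 q^e by 7 interchanges the roles of the two squares,
      so the uniqueness lemma applies to q^e with T as first coordinate.\<close>
    have R7: "\<exists>r. R m n = 7 * r \<and> q^e = (T m n)^2 + 7 * r^2 \<and> coprime (T m n) r"
      if "polyA m n = 7 * q^e" "coprime m n" for m n
    proof -
      have "(R m n)^2 = 7 * (q^e - (T m n)^2)" using that(1) A[of m n] by simp
      hence "7 dvd (R m n)^2" by simp
      hence "7 dvd R m n" using p7 prime_dvd_power by blast
      then obtain r where r: "R m n = 7 * r" by blast
      moreover have "q^e = (T m n)^2 + 7 * r^2"
        using that(1) A[of m n] r by (simp add: power_mult_distrib)
      ultimately show ?thesis using RT[OF that(2)] by (auto simp: coprime_commute)
    qed
    obtain r where r: "R m n = 7 * r" "q^e = (T m n)^2 + 7 * r^2" "coprime (T m n) r"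
      using R7 q(3) cop(1) by blast
    obtain r' where r': "q^e = (T m' n')^2 + 7 * r'^2" "coprime (T m' n') r'"
      using R7 q(3) eq cop(2) by metis
    \<comment> \<open>If q were 7, then 7 would divide T as well as R.\<close>
    have "q \<noteq> 7"
    proof
      assume "q = 7"
      hence "7 dvd (T m n)^2 + 7 * r^2" unfolding r(2)[symmetric] using q(2) by simp
      hence "7 dvd (T m n)^2" by presburger
      hence "7 dvd T m n" using p7 prime_dvd_power by blast
      thus False using r(1) RT[OF cop(1)] by (auto dest: coprime_common_divisor[of _ _ 7])
    qed
    hence "r'^2 = r^2"
      using x2_plus_7y2_prime_power_unique[of q e "T m' n'" r' "T m n" r]
        q \<open>odd q\<close> r r' by simp
    thus ?thesis using r(2) r'(1) by simp
  qed
  thus ?thesis by (simp add: polyB_eq T_def)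
qed

section \<open>The norm form\<close>

text \<open>The exponents 1, 2, 4 form the subgroup of squares modulo 7, so this is the relative norm
  to $\mathbb{Q}(\sqrt{-7})$; replacing $z$ by $z^3$ gives the conjugate factor.\<close>
lemma relative_norm_sqrt_minus_7:
  fixes z m n :: complex
  assumes "1 + z + z^2 + z^3 + z^4 + z^5 + z^6 = 0"
  shows "(m - (z + z^2) * n) * (m - (z^2 + z^4) * n) * (m - (z^4 + z) * n)
    = m^3 + m^2*n - 2*m*n^2 - n^3 - (2 * (z + z^2 + z^4) + 1) * (m * n * (m + n))"
  using assms by algebra

lemma zeta7_root: "zeta7^7 = 1" "1 + zeta7 + zeta7^2 + zeta7^3 + zeta7^4 + zeta7^5 + zeta7^6 = 0"
proof -
  have z: "zeta7 = cis (2 * pi / 7)"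
    unfolding zeta7_def cis_conv_exp by (simp add: mult.commute)
  show 7: "zeta7^7 = 1" unfolding z by (simp add: DeMoivre)
  have "sin (2 * pi / 7) > 0" by (rule sin_gt_zero) auto
  hence "zeta7 \<noteq> 1" unfolding z by (auto simp: complex_eq_iff)
  moreover have "(zeta7 - 1) * (1 + zeta7 + zeta7^2 + zeta7^3 + zeta7^4 + zeta7^5 + zeta7^6) = 0"
    using 7 by algebra
  ultimately show "1 + zeta7 + zeta7^2 + zeta7^3 + zeta7^4 + zeta7^5 + zeta7^6 = 0" by simp
qed

lemma norm_elt_eq_polyA: "norm_elt m n = of_int (polyA m n)"
proof -
  define z where "z = zeta7"
  define a b :: complex where "a = of_int m" and "b = of_int n"
  have z7: "z^7 = 1" and z0: "1 + z + z^2 + z^3 + z^4 + z^5 + z^6 = 0"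
    using zeta7_root by (auto simp: z_def)
  have red: "z^8 = z" "z^9 = z^2" "z^10 = z^3" "z^12 = z^5" "z^15 = z" "z^18 = z^4"
    using z7 by algebra+
  have pows: "(z^3)^2 = z^6" "(z^3)^3 = z^2" "(z^3)^4 = z^5" "(z^3)^5 = z" "(z^3)^6 = z^4"
    unfolding power_mult[symmetric] using red by simp_all
  have z0': "1 + z^3 + (z^3)^2 + (z^3)^3 + (z^3)^4 + (z^3)^5 + (z^3)^6 = 0"
    unfolding pows using z0 by (simp add: add_ac)
  define f where "f k = a - (z^k + z^(2*k)) * b" for k :: nat
  have "{1..6::nat} = {1, 2, 3, 4, 5, 6}" by auto
  \<comment> \<open>The exponents are grouped into squares and nonsquares modulo 7.\<close>
  hence "norm_elt m n = (f 1 * f 2 * f 4) * (f 3 * f 6 * f 5)"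
    unfolding norm_elt_def f_def z_def[symmetric] a_def[symmetric] b_def[symmetric]
    by (simp only: mult_ac) simp
  also have "\<dots> = ((a - (z + z^2) * b) * (a - (z^2 + z^4) * b) * (a - (z^4 + z) * b))
      * ((a - (z^3 + z^6) * b) * (a - (z^6 + z^5) * b) * (a - (z^5 + z^3) * b))"
    by (simp add: f_def red)
  also have "\<dots> = (a^3 + a^2*b - 2*a*b^2 - b^3 - (2 * (z + z^2 + z^4) + 1) * (a * b * (a + b)))
      * (a^3 + a^2*b - 2*a*b^2 - b^3 - (2 * (z^3 + z^6 + z^5) + 1) * (a * b * (a + b)))"
    unfolding relative_norm_sqrt_minus_7[OF z0] relative_norm_sqrt_minus_7[OF z0', unfolded pows] ..
  also have "\<dots> = a^6 + 2*a^5*b + 4*a^4*b^2 + 8*a^3*b^3 + 9*a^2*b^4 + 4*a*b^5 + b^6"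
  proof -
    \<comment> \<open>This is the quadratic Gauss period: (2w + 1)^2 = -7, and the conjugate period
      is -1 - w. The product of the two factors is therefore R^2 + 7 T^2.\<close>
    define w where "w = z + z^2 + z^4"
    have w': "z^3 + z^6 + z^5 = - 1 - w" using z0 unfolding w_def by algebra
    have w: "w^2 + w + 2 = 0" using z0 unfolding w_def by algebra
    show ?thesis unfolding w' w_def[symmetric] using w by algebra
  qed
  also have "\<dots> = of_int (polyA m n)"
    by (simp add: polyA_def a_def b_def)
  finally show ?thesis .
qed

theorem theorem2:
  fixes m n :: int and c :: rat
  assumes "gcd m n = 1" and "m * n * (m + n) \<noteq> 0"
    and "c = - of_int (polyA m n) / of_int (polyB m n)"
  shows
    "(coprime (polyA m n) (polyB m n) \<and> rden c = polyB m n
        \<and> 2 dvd m * n * (m + n) \<and> polyB m n = 16 * (polyC m n)^2)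
     \<and> (of_rat c :: complex) = - norm_elt m n / (of_int (4 * polyC m n))^2
     \<and> (has_rat_3cycle (-29/16) \<and>
        (\<forall>c'. has_rat_3cycle c' \<and> (\<exists>k::nat. rden c' = 2^k) \<longrightarrow> c' = -29/16))
     \<and> ((\<forall>c'. has_rat_3cycle c' \<and> rden c' = rden c \<longrightarrow> c' = c) \<longrightarrow> c = -29/16)
     \<and> (((\<exists>q e. prime q \<and> q \<noteq> 7 \<and> e \<ge> 1 \<and> polyA m n = q ^ e)
          \<or> (\<exists>q e. prime q \<and> e \<ge> 1 \<and> polyA m n = 7 * q ^ e))
         \<longrightarrow> (\<forall>c'. has_rat_3cycle c' \<and> rnum c' = - polyA m n \<longrightarrow> c' = c))"
proof -
  have cop: "coprime m n" using assms(1) by (simp add: coprime_iff_gcd_eq_1)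
  have q: "quotient_of c = (- polyA m n, polyB m n)"
    unfolding assms(3) by (rule quotient_of_polyA_polyB[OF cop assms(2)])
  have num_den: "rnum c = - polyA m n" "rden c = polyB m n"
    by (simp_all add: rnum_def rden_def q)
  have a: "coprime (polyA m n) (polyB m n) \<and> rden c = polyB m n
        \<and> 2 dvd m * n * (m + n) \<and> polyB m n = 16 * (polyC m n)^2"
    using coprime_polyA_polyB[OF cop] num_den(2) even_mn_sum polyB_eq_polyC by blast
  have b: "(of_rat c :: complex) = - norm_elt m n / (of_int (4 * polyC m n))^2"
    unfolding assms(3) norm_elt_eq_polyA polyB_eq_polyC
    by (simp add: of_rat_divide of_rat_minus of_rat_mult of_rat_power power_mult_distrib)
  have param: "\<exists>m' n'. coprime m' n' \<and> m' * n' * (m' + n') \<noteq> 0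
      \<and> c' = - of_int (polyA m' n') / of_int (polyB m' n')
      \<and> rnum c' = - polyA m' n' \<and> rden c' = polyB m' n'" if "has_rat_3cycle c'" for c'
    using has_rat_3cycle_imp_polyA_polyB[OF that] quotient_of_polyA_polyB
    by (metis rnum_def rden_def fst_conv snd_conv)
  have c1: "has_rat_3cycle (-29/16)"
    \<comment> \<open>A(1,1) = 29 and B(1,1) = 16.\<close>
    using has_rat_3cycle_polyA_polyB[of 1 1] by (simp add: polyA_def polyB_def)
  have c2: "c' = -29/16" if c': "has_rat_3cycle c'" "rden c' = 2^k" for c' and k :: nat
  proof -
    obtain m' n' where mn': "coprime m' n'" "m' * n' * (m' + n') \<noteq> 0"
      "c' = - of_int (polyA m' n') / of_int (polyB m' n')" "rden c' = polyB m' n'"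
      using param[OF c'(1)] by blast
    have "polyB m' n' = 2^k" using mn'(4) c'(2) by simp
    from isosceles_if_polyB_power_2[OF mn'(1,2) this] show ?thesis
      unfolding mn'(3) by (rule polyA_div_polyB_isosceles[OF mn'(2)])
  qed
  have d: "c = -29/16" if uniq: "\<forall>c'. has_rat_3cycle c' \<and> rden c' = rden c \<longrightarrow> c' = c"
  proof -
    \<comment> \<open>Swapping m and n keeps the denominator, so uniqueness forces A(n,m) =
      A(m,n).\<close>
    define c' :: rat where "c' = - of_int (polyA n m) / of_int (polyB n m)"
    have nz: "n * m * (n + m) \<noteq> 0" using assms(2) by (simp add: mult.commute add.commute)
    have q': "quotient_of c' = (- polyA n m, polyB n m)"
      unfolding c'_def using cop nz by (intro quotient_of_polyA_polyB) (simp_all add: coprime_commute)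
    have "polyB n m = polyB m n" by (simp add: polyB_eq mult.commute add.commute)
    hence "rden c' = rden c" using q' num_den(2) by (simp add: rden_def)
    moreover have "has_rat_3cycle c'" unfolding c'_def by (rule has_rat_3cycle_polyA_polyB[OF nz])
    ultimately have "c' = c" using uniq by blast
    hence "polyA n m = polyA m n" using q q' by simp
    hence "(m - n) * (2*m + n) * (m + 2*n) = 0" using polyA_swap_diff[of n m] assms(2) by simp
    hence "m = n \<or> n = - 2 * m \<or> m = - 2 * n" by auto
    thus ?thesis unfolding assms(3) by (rule polyA_div_polyB_isosceles[OF assms(2)])
  qed
  have e: "c' = c"
    if pp: "(\<exists>q e. prime q \<and> q \<noteq> 7 \<and> e \<ge> 1 \<and> polyA m n = q ^ e)
          \<or> (\<exists>q e. prime q \<and> e \<ge> 1 \<and> polyA m n = 7 * q ^ e)"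
      and c': "has_rat_3cycle c'" "rnum c' = - polyA m n" for c'
  proof -
    obtain m' n' where mn': "coprime m' n'"
      "c' = - of_int (polyA m' n') / of_int (polyB m' n')" "rnum c' = - polyA m' n'"
      using param[OF c'(1)] by blast
    have "polyA m' n' = polyA m n" using mn'(3) c'(2) by simp
    thus ?thesis
      using polyB_unique_prime_power[OF cop mn'(1) _ pp] by (simp add: mn'(2) assms(3))
  qed
  show ?thesis using a b c1 c2 d e by blast
qed

end
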